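(* Let $A_1,\dots,A_m$ be pairwise commuting real $d\times d$ matrices, let $\ell\in\mathbb{R}^d$ be a fixed vector, and let $\varphi:\mathbb{R}^m\to\mathbb{R}^d$, $\varphi(t)=\exp\left(-\sum_{k=1}^m t_kA_k\right)^T\ell$. Suppose there exist a countable set $\Lambda\subset\mathbb{R}^d$, a Borel set $\Omega\subset\mathbb{R}^m$ of finite positive Lebesgue measure and a set $\Gamma\subset\mathbb{R}^m$ such that, with $\mu$ denoting Lebesgue measure on $\mathbb{R}^m$ restricted to $\Omega$: (a) $\varphi$ is $\mu$-essentially injective; (b) the pushforward $\varphi_*\mu$ is a spectral measure with spectrum $\Lambda$ (respectively, a frame-spectral measure with frame spectrum $\Lambda$); (c) $\{\Omega+\gamma:\gamma\in\Gamma\}$ tiles $\mathbb{R}^m$. Then the system $$\left\{s\mapsto e^{2\pi i\varphi(s-\gamma)\cdot\lambda}1_\Omega(s-\gamma):\lambda\in\Lambda,\ \gamma\in\Gamma\right\}$$ is an orthogonal basis (respectively, a frame) for $L^2(\mathbb{R}^m)$. In other words, $\{\pi(\gamma\bullet\lambda,\gamma)1_\Omega:(\lambda,\gamma)\in\Lambda\times\Gamma\}$ is an orthogonal basis (respectively, a frame) for $L^2(\mathbb{R}^m)$.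
   Context: For $t\in\mathbb{R}^m$ and $y\in\mathbb{R}^d$, $t\bullet y=\exp\left(\sum_{k=1}^m t_kA_k\right)y$. The group $G=\mathbb{R}^d\rtimes\mathbb{R}^m$ has product $(x,t)(y,s)=(x+t\bullet y,\,t+s)$, and $\pi$ is the unitary representation of $G$ on $L^2(\mathbb{R}^m)$ given by $[\pi(x,t)f](s)=e^{2\pi i\varphi(s)\cdot x}f(s-t)$. The map $\varphi$ is $\mu$-essentially injective if for every $f\in L^2(\mu)$ there is $h\in L^2(\varphi_*\mu)$ with $f=h\circ\varphi$ $\mu$-a.e., where $\varphi_*\mu(E)=\mu(\varphi^{-1}(E))$ for Borel $E\subset\mathbb{R}^d$. A finite Borel measure $\nu$ on $\mathbb{R}^d$ is a spectral measure with spectrum $\Lambda$ (respectively, a frame-spectral measure with frame spectrum $\Lambda$) if $\{e^{2\pi i\lambda\cdot x}\}_{\lambda\in\Lambda}$ is an orthogonal basis (respectively, a frame) for $L^2(\nu)$; a spectrum is a countable discrete set. A countable family $\{x_n\}$ in a Hilbert space $\mathcal{H}$ is a frame if there are $0<A\le B<\infty$ with $A\|x\|^2\le\sum_n|\langle x,x_n\rangle|^2\le B\|x\|^2$ for all $x\in\mathcal{H}$. $\{\Omega+\gamma:\gamma\in\Gamma\}$ tiles $\mathbb{R}^m$ if $\Omega+\gamma$ and $\Omega+\gamma'$ intersect in a Lebesgue null set for all distinct $\gamma,\gamma'\in\Gamma$ and $\bigcup_{\gamma\in\Gamma}(\Omega+\gamma)=\mathbb{R}^m$. *)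

theory Defs
  imports "HOL-Analysis.Analysis"
begin

section \<open>The space of square-integrable complex functions\<close>

text \<open>Elements of \<open>L2 M\<close> are functions, not almost-everywhere classes: equality in the Hilbert
  space is equality almost everywhere, and zero vectors are the functions of norm 0.\<close>

definition L2 :: "'a measure \<Rightarrow> ('a \<Rightarrow> complex) set" where
  "L2 M = {f \<in> borel_measurable M. integrable M (\<lambda>x. (cmod (f x))\<^sup>2)}"

definition L2_inner :: "'a measure \<Rightarrow> ('a \<Rightarrow> complex) \<Rightarrow> ('a \<Rightarrow> complex) \<Rightarrow> complex" where
  "L2_inner M f g = (\<integral>x. f x * cnj (g x) \<partial>M)"

definition L2_norm :: "'a measure \<Rightarrow> ('a \<Rightarrow> complex) \<Rightarrow> real" where
  "L2_norm M f = sqrt (\<integral>x. (cmod (f x))\<^sup>2 \<partial>M)"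

definition orthogonal_basis_L2 ::
    "'a measure \<Rightarrow> 'i set \<Rightarrow> ('i \<Rightarrow> 'a \<Rightarrow> complex) \<Rightarrow> bool" where
  "orthogonal_basis_L2 M I e \<longleftrightarrow>
     (\<forall>i\<in>I. e i \<in> L2 M \<and> L2_norm M (e i) \<noteq> 0) \<and>
     (\<forall>i\<in>I. \<forall>j\<in>I. i \<noteq> j \<longrightarrow> L2_inner M (e i) (e j) = 0) \<and>
     (\<forall>f\<in>L2 M. \<forall>\<epsilon>>0. \<exists>F c. finite F \<and> F \<subseteq> I \<and>
        L2_norm M (\<lambda>x. f x - (\<Sum>i\<in>F. c i * e i x)) < \<epsilon>)"

text \<open>Summability is required explicitly because \<open>infsum\<close> is 0 on non-summable families.\<close>

definition frame_L2 ::
    "'a measure \<Rightarrow> 'i set \<Rightarrow> ('i \<Rightarrow> 'a \<Rightarrow> complex) \<Rightarrow> bool" where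
  "frame_L2 M I e \<longleftrightarrow>
     countable I \<and> (\<forall>i\<in>I. e i \<in> L2 M) \<and>
     (\<exists>A B::real. 0 < A \<and> A \<le> B \<and>
        (\<forall>f\<in>L2 M.
           (\<lambda>i. (cmod (L2_inner M f (e i)))\<^sup>2) summable_on I \<and>
           A * (L2_norm M f)\<^sup>2 \<le> (\<Sum>\<^sub>\<infinity>i\<in>I. (cmod (L2_inner M f (e i)))\<^sup>2) \<and>
           (\<Sum>\<^sub>\<infinity>i\<in>I. (cmod (L2_inner M f (e i)))\<^sup>2) \<le> B * (L2_norm M f)\<^sup>2))"

section \<open>Spectral measures, essential injectivity and tilings\<close>

definition spectral_measure ::
    "'a::euclidean_space measure \<Rightarrow> 'a set \<Rightarrow> bool" where
  "spectral_measure \<nu> \<Lambda> \<longleftrightarrow>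
     sets \<nu> = sets borel \<and> finite_measure \<nu> \<and> countable \<Lambda> \<and> discrete \<Lambda> \<and>
     orthogonal_basis_L2 \<nu> \<Lambda> (\<lambda>l x. cis (2 * pi * (l \<bullet> x)))"

definition frame_spectral_measure ::
    "'a::euclidean_space measure \<Rightarrow> 'a set \<Rightarrow> bool" where
  "frame_spectral_measure \<nu> \<Lambda> \<longleftrightarrow>
     sets \<nu> = sets borel \<and> finite_measure \<nu> \<and> countable \<Lambda> \<and> discrete \<Lambda> \<and>
     frame_L2 \<nu> \<Lambda> (\<lambda>l x. cis (2 * pi * (l \<bullet> x)))"

definition ess_injective :: "'a measure \<Rightarrow> ('a \<Rightarrow> 'b::topological_space) \<Rightarrow> bool" where
  "ess_injective M \<phi> \<longleftrightarrow>
     (\<forall>f\<in>L2 M. \<exists>h\<in>L2 (distr M borel \<phi>). AE x in M. f x = h (\<phi> x))"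

definition tiles :: "'a::euclidean_space set \<Rightarrow> 'a set \<Rightarrow> bool" where
  "tiles \<Omega> \<Gamma> \<longleftrightarrow>
     (\<forall>\<gamma>\<in>\<Gamma>. \<forall>\<gamma>'\<in>\<Gamma>. \<gamma> \<noteq> \<gamma>' \<longrightarrow>
        (\<lambda>x. x + \<gamma>) ` \<Omega> \<inter> (\<lambda>x. x + \<gamma>') ` \<Omega> \<in> null_sets lebesgue) \<and>
     (\<Union>\<gamma>\<in>\<Gamma>. (\<lambda>x. x + \<gamma>) ` \<Omega>) = UNIV"

section \<open>The action, the orbit map and the representation\<close>

text \<open>The ring structure on \<^typ>\<open>real^'d^'d\<close> is componentwise, so neither \<open>exp\<close> nor \<open>^\<close> is the
  matrix operation; the exponential series is written with the matrix product.\<close>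

definition matrix_exp :: "real^'d^'d \<Rightarrow> real^'d^'d" where
  "matrix_exp X = (\<Sum>n. (1 / fact n) *\<^sub>R (((**) X ^^ n) (mat 1)))"

definition action :: "('m::finite \<Rightarrow> real^'d^'d) \<Rightarrow> real^'m \<Rightarrow> real^'d \<Rightarrow> real^'d" where
  "action A t y = matrix_exp (\<Sum>k\<in>UNIV. (t $ k) *\<^sub>R A k) *v y"

definition orbit_map :: "('m::finite \<Rightarrow> real^'d^'d) \<Rightarrow> real^'d \<Rightarrow> real^'m \<Rightarrow> real^'d" where
  "orbit_map A l t = transpose (matrix_exp (- (\<Sum>k\<in>UNIV. (t $ k) *\<^sub>R A k))) *v l"

definition repr ::
    "('m::finite \<Rightarrow> real^'d^'d) \<Rightarrow> real^'d \<Rightarrow> (real^'d) \<times> (real^'m) \<Rightarrow>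
      (real^'m \<Rightarrow> complex) \<Rightarrow> (real^'m \<Rightarrow> complex)" where
  "repr A l = (\<lambda>(x, t) f s. cis (2 * pi * (orbit_map A l s \<bullet> x)) * f (s - t))"

end

theory Submission
  imports Defs
begin

text \<open>Translating by \<open>\<gamma>\<close> identifies the square-integrable functions on the tile \<open>\<Omega> + \<gamma>\<close> with those on
\<open>\<Omega>\<close>. Since the tiles overlap only in null sets and there are countably many of them, the whole
space \<open>L\<^sup>2(\<real>\<^sup>m)\<close> is thereby the orthogonal direct sum of copies of \<open>L\<^sup>2(\<Omega>)\<close> indexed by \<open>\<Gamma>\<close>
(\<open>has_sum_L2_norm_tiles\<close> is the resulting Pythagorean identity). An orthogonal basis or a frame of
\<open>L\<^sup>2(\<Omega>)\<close>, copied to every tile, is therefore an orthogonal basis or a frame, with the same frame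
bounds, of \<open>L\<^sup>2(\<real>\<^sup>m)\<close>; these are the lemmas \<open>orthogonal_basis_L2_tile_lift\<close> and
\<open>frame_L2_tile_lift\<close>.

A basis of \<open>L\<^sup>2(\<Omega>)\<close> comes from the pushforward measure: composition with \<open>\<phi>\<close> is an isometry from
\<open>L\<^sup>2(\<phi>\<^sub>*\<mu>)\<close> into \<open>L\<^sup>2(\<mu>)\<close>, and essential injectivity of \<open>\<phi>\<close> says precisely that it is onto. So the
exponentials of the spectrum pull back to a basis (or frame) of \<open>L\<^sup>2(\<mu>)\<close>; see
\<open>orthogonal_basis_L2_distr\<close> and \<open>frame_L2_distr\<close>.

Finally the system given by the representation is the same system of functions: because the matrices
commute, \<open>exp(-s\<cdot>A) exp(\<gamma>\<cdot>A) = exp(-(s - \<gamma>)\<cdot>A)\<close>, whence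
\<open>\<phi>(s) \<cdot> (\<gamma> \<bullet> \<lambda>) = \<phi>(s - \<gamma>) \<cdot> \<lambda>\<close> (\<open>orbit_map_inner_action\<close>).\<close>

section \<open>The matrix exponential of commuting matrices and the orbit map\<close>

text \<open>The ring multiplication of the matrix type is the entrywise product, so the exponential law of normed
algebras says nothing about \<open>matrix_exp\<close>. Bilinearity of the matrix product is what its proof needs.\<close>

lemma bounded_bilinear_matrix_mult:
  "bounded_bilinear ((**) :: real^'d^'d \<Rightarrow> real^'d^'d \<Rightarrow> real^'d^'d)"
proof -
  have "bilinear ((**) :: real^'d^'d \<Rightarrow> real^'d^'d \<Rightarrow> real^'d^'d)"
    unfolding bilinear_def
    by (auto intro!: linearI simp: vec_eq_iff matrix_matrix_mult_def sum.distrib distrib_left distrib_right sum_distrib_left mult_ac)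
  then show ?thesis
    by (simp add: bilinear_conv_bounded_bilinear)
qed

interpretation mm: bounded_bilinear "(**) :: real^'d^'d \<Rightarrow> real^'d^'d \<Rightarrow> real^'d^'d"
  by (rule bounded_bilinear_matrix_mult)

definition exp_term :: "real^'d^'d \<Rightarrow> nat \<Rightarrow> real^'d^'d" where
  "exp_term X n = (1 / fact n) *\<^sub>R (((**) X ^^ n) (mat 1))"

lemma matrix_exp_eq_suminf: "matrix_exp X = (\<Sum>n. exp_term X n)"
  by (simp add: matrix_exp_def exp_term_def)

lemma exp_term_0 [simp]: "exp_term X 0 = mat 1"
  by (simp add: exp_term_def)

lemma mult_exp_term: "X ** exp_term X n = real (Suc n) *\<^sub>R exp_term X (Suc n)"
  by (simp add: exp_term_def mm.scaleR_right del: of_nat_Suc)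

lemma summable_norm_exp_term:
  fixes X :: "real^'d^'d"
  shows "summable (\<lambda>n. norm (exp_term X n))"
proof -
  obtain K where "0 \<le> K" and K: "\<And>(A::real^'d^'d) (B::real^'d^'d). norm (A ** B) \<le> norm A * norm B * K"
    using mm.nonneg_bounded by blast
  then have pos: "0 \<le> norm X * K"
    by simp
  have "norm (((**) X ^^ n) (mat 1)) \<le> (norm X * K) ^ n * norm (mat 1 :: real^'d^'d)" for n
  proof (induction n)
    case (Suc n)
    have "norm (((**) X ^^ Suc n) (mat 1)) \<le> (norm X * K) * norm (((**) X ^^ n) (mat 1))"
      using K[of X "((**) X ^^ n) (mat 1)"] by (simp add: mult_ac)
    also have "\<dots> \<le> (norm X * K) * ((norm X * K) ^ n * norm (mat 1 :: real^'d^'d))"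
      using Suc pos by (intro mult_left_mono)
    finally show ?case by (simp add: mult_ac)
  qed simp
  note bound = this
  have "norm (exp_term X n) \<le> norm (mat 1 :: real^'d^'d) * ((norm X * K) ^ n /\<^sub>R fact n)" for n
    using divide_right_mono[OF bound[of n], of "fact n"] by (simp add: exp_term_def field_simps)
  then show ?thesis
    by (intro summable_comparison_test'[OF summable_mult[OF summable_exp_generic[of "norm X * K"]], of 0 _ "norm (mat 1 :: real^'d^'d)"]) simp
qed

text \<open>Each entry of a product of two matrix series is a finite sum of products of scalar series, so the
exponential law reduces to scalar Cauchy products, which need absolute convergence entry by entry.\<close>

lemma summable_norm_exp_term_entry: "summable (\<lambda>n. norm (exp_term X n $ i $ j))"
proof (rule summable_comparison_test'[OF summable_norm_exp_term[of X], of 0])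
  fix n
  have "norm (exp_term X n $ i $ j) \<le> norm (exp_term X n $ i)"
    by (rule Finite_Cartesian_Product.norm_nth_le)
  also have "\<dots> \<le> norm (exp_term X n)"
    by (rule Finite_Cartesian_Product.norm_nth_le)
  finally show "norm (norm (exp_term X n $ i $ j)) \<le> norm (exp_term X n)"
    by simp
qed

lemma exp_term_sums: "exp_term X sums matrix_exp X"
  unfolding matrix_exp_eq_suminf by (rule summable_sums[OF summable_norm_cancel[OF summable_norm_exp_term]])

lemma exp_term_entry_sums: "(\<lambda>n. exp_term X n $ i $ j) sums (matrix_exp X $ i $ j)"
  by (intro bounded_linear.sums[OF bounded_linear_vec_nth] exp_term_sums)

lemma exp_term_commute:
  assumes "X ** Y = Y ** X"
  shows "exp_term X n ** Y = Y ** exp_term X n"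
proof -
  have "((**) X ^^ n) (mat 1) ** Y = Y ** ((**) X ^^ n) (mat 1)"
  proof (induction n)
    case (Suc n)
    let ?P = "((**) X ^^ n) (mat 1)"
    have "(X ** ?P) ** Y = X ** (?P ** Y)"
      by (simp only: matrix_mul_assoc)
    also have "\<dots> = (X ** Y) ** ?P"
      by (simp only: Suc matrix_mul_assoc)
    also have "\<dots> = Y ** (X ** ?P)"
      by (simp only: assms matrix_mul_assoc)
    finally show ?case
      by simp
  qed simp
  then show ?thesis
    by (simp add: exp_term_def mm.scaleR_left mm.scaleR_right)
qed

text \<open>The binomial theorem for commuting matrices, with the factorials absorbed into the terms so that the
coefficients become trivial. In the induction step \<open>X\<close> raises the first index and \<open>Y\<close> the second; the
two resulting weights \<open>i\<close> and \<open>n + 1 - i\<close> add up to \<open>n + 1\<close>.\<close>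

lemma exp_term_add_commuting:
  fixes X Y :: "real^'d^'d"
  assumes comm: "X ** Y = Y ** X"
  shows "exp_term (X + Y) n = (\<Sum>i\<le>n. exp_term X i ** exp_term Y (n - i))"
proof (induction n)
  case (Suc n)
  let ?P = "\<lambda>i j. exp_term X i ** exp_term Y j"
  have "real (Suc n) *\<^sub>R exp_term (X + Y) (Suc n) = (X + Y) ** (\<Sum>i\<le>n. ?P i (n - i))"
    by (metis Suc.IH mult_exp_term)
  also have "\<dots> = (\<Sum>i\<le>n. X ** ?P i (n - i)) + (\<Sum>i\<le>n. Y ** ?P i (n - i))"
    by (simp add: mm.add_left mm.sum_right sum.distrib)
  also have "(\<Sum>i\<le>n. X ** ?P i (n - i)) = (\<Sum>i\<le>n. real (Suc i) *\<^sub>R ?P (Suc i) (n - i))"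
    by (simp add: matrix_mul_assoc mult_exp_term mm.scaleR_left del: of_nat_Suc)
  also have "\<dots> = (\<Sum>i\<le>Suc n. real i *\<^sub>R ?P i (Suc n - i))"
    by (subst sum.atMost_Suc_shift) simp
  also have "(\<Sum>i\<le>n. Y ** ?P i (n - i)) = (\<Sum>i\<le>n. real (Suc n - i) *\<^sub>R ?P i (Suc n - i))"
  proof (rule sum.cong[OF refl])
    fix i assume "i \<in> {..n}"
    have "Y ** ?P i (n - i) = exp_term X i ** (Y ** exp_term Y (n - i))"
      by (simp add: matrix_mul_assoc exp_term_commute[OF comm])
    then show "Y ** ?P i (n - i) = real (Suc n - i) *\<^sub>R ?P i (Suc n - i)"
      using \<open>i \<in> {..n}\<close> by (simp add: mult_exp_term mm.scaleR_right Suc_diff_le del: of_nat_Suc)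
  qed
  also have "\<dots> = (\<Sum>i\<le>Suc n. real (Suc n - i) *\<^sub>R ?P i (Suc n - i))"
    by simp
  also have "(\<Sum>i\<le>Suc n. real i *\<^sub>R ?P i (Suc n - i)) + (\<Sum>i\<le>Suc n. real (Suc n - i) *\<^sub>R ?P i (Suc n - i))
      = real (Suc n) *\<^sub>R (\<Sum>i\<le>Suc n. ?P i (Suc n - i))"
    unfolding scaleR_right.sum sum.distrib[symmetric] scaleR_add_left[symmetric] of_nat_add[symmetric]
    by (intro sum.cong) auto
  finally show ?case
    by (simp del: sum.cl_ivl_Suc of_nat_Suc)
qed simp

lemma matrix_exp_add_commuting:
  fixes X Y :: "real^'d^'d"
  assumes "X ** Y = Y ** X"
  shows "matrix_exp (X + Y) = matrix_exp X ** matrix_exp Y"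
proof -
  have "matrix_exp (X + Y) $ i $ j = (matrix_exp X ** matrix_exp Y) $ i $ j" for i j
  proof -
    have "(\<lambda>n. \<Sum>p\<le>n. exp_term X p $ i $ k * exp_term Y (n - p) $ k $ j)
            sums (matrix_exp X $ i $ k * matrix_exp Y $ k $ j)" for k
      using Cauchy_product_sums[OF summable_norm_exp_term_entry[of X i k] summable_norm_exp_term_entry[of Y k j]]
      by (simp add: sums_unique[OF exp_term_entry_sums])
    then have "(\<lambda>n. \<Sum>k\<in>UNIV. \<Sum>p\<le>n. exp_term X p $ i $ k * exp_term Y (n - p) $ k $ j)
            sums (\<Sum>k\<in>UNIV. matrix_exp X $ i $ k * matrix_exp Y $ k $ j)"
      by (intro sums_sum)
    moreover have "(\<Sum>k\<in>UNIV. \<Sum>p\<le>n. exp_term X p $ i $ k * exp_term Y (n - p) $ k $ j)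
        = exp_term (X + Y) n $ i $ j" for n
      by (subst sum.swap) (simp add: exp_term_add_commuting[OF assms] matrix_matrix_mult_def)
    ultimately have "(\<lambda>n. exp_term (X + Y) n $ i $ j) sums ((matrix_exp X ** matrix_exp Y) $ i $ j)"
      by (simp add: matrix_matrix_mult_def)
    then show ?thesis
      using exp_term_entry_sums sums_unique2 by blast
  qed
  then show ?thesis by (simp add: vec_eq_iff)
qed

text \<open>The intertwining identity which turns \<open>\<pi>(\<gamma> \<bullet> \<lambda>, \<gamma>)\<close> into a translate: moving the
transposed exponential of the orbit map to the other side of the inner product puts it next to the
exponential of the action, and the two merge because all the matrices commute.\<close>

lemma orbit_map_inner_action:
  fixes A :: "'m::finite \<Rightarrow> real^'d^'d"
  assumes "\<And>j k. A j ** A k = A k ** A j"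
  shows "orbit_map A l s \<bullet> action A t y = orbit_map A l (s - t) \<bullet> y"
proof -
  let ?S = "\<lambda>t::real^'m. \<Sum>k\<in>UNIV. (t $ k) *\<^sub>R A k"
  have "?S s ** ?S t = (\<Sum>j\<in>UNIV. \<Sum>k\<in>UNIV. (s $ j * t $ k) *\<^sub>R (A j ** A k))"
    by (subst mm.sum_left) (simp add: mm.sum_right mm.scaleR_left mm.scaleR_right scaleR_sum_right mult.commute)
  also have "\<dots> = (\<Sum>k\<in>UNIV. \<Sum>j\<in>UNIV. (t $ k * s $ j) *\<^sub>R (A k ** A j))"
    by (subst sum.swap) (intro sum.cong refl, simp only: mult.commute, subst assms, rule refl)
  also have "\<dots> = ?S t ** ?S s"
    by (subst mm.sum_left) (simp add: mm.sum_right mm.scaleR_left mm.scaleR_right scaleR_sum_right mult.commute)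
  finally have comm: "(- ?S s) ** ?S t = ?S t ** (- ?S s)"
    by (simp only: mm.minus_left mm.minus_right)
  have "- ?S (s - t) = - ?S s + ?S t"
    by (simp add: scaleR_left_diff_distrib sum_subtractf)
  then have "matrix_exp (- ?S (s - t)) = matrix_exp (- ?S s) ** matrix_exp (?S t)"
    using matrix_exp_add_commuting[OF comm] by simp
  then show ?thesis
    by (simp add: orbit_map_def action_def dot_lmul_matrix matrix_vector_mul_assoc)
qed

text \<open>The terms of the exponential series are continuous in \<open>t\<close>, and the pointwise sum of a series of
measurable functions is measurable.\<close>

lemma orbit_map_measurable [measurable]:
  fixes A :: "'m::finite \<Rightarrow> real^'d^'d"
  shows "orbit_map A l \<in> borel_measurable borel"
proof -
  let ?S = "\<lambda>t::real^'m. - (\<Sum>k\<in>UNIV. (t $ k) *\<^sub>R A k)"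
  have "continuous_on UNIV (\<lambda>t. ((**) (?S t) ^^ n) (mat 1))" for n
    by (induction n) (auto intro!: mm.continuous_on continuous_intros)
  then have "(\<lambda>t. exp_term (?S t) n) \<in> borel_measurable borel" for n
    unfolding exp_term_def by (intro borel_measurable_continuous_onI continuous_intros)
  then have [measurable]: "(\<lambda>t. matrix_exp (?S t)) \<in> borel_measurable borel"
    unfolding matrix_exp_eq_suminf by (rule borel_measurable_suminf)
  have "linear (\<lambda>M::real^'d^'d. transpose M *v l)"
    by (intro linearI) (auto simp: vec_eq_iff matrix_vector_mult_def transpose_def sum.distrib algebra_simps sum_distrib_left)
  then have [measurable]: "(\<lambda>M::real^'d^'d. transpose M *v l) \<in> borel_measurable borel"
    by (intro borel_measurable_continuous_onI linear_continuous_on linear_linear[THEN iffD2] ) (simp add: linear_conv_bounded_linear)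
  show ?thesis
    unfolding orbit_map_def[abs_def] by measurable
qed

section \<open>Square-integrable functions and push-forward measures\<close>

lemma L2_measurable: "f \<in> L2 M \<Longrightarrow> f \<in> borel_measurable M"
  by (simp add: L2_def)

lemma L2_integrable: "f \<in> L2 M \<Longrightarrow> integrable M (\<lambda>x. (cmod (f x))\<^sup>2)"
  by (simp add: L2_def)

lemma L2_norm_sq: "(L2_norm M f)\<^sup>2 = (\<integral>x. (cmod (f x))\<^sup>2 \<partial>M)"
  by (simp add: L2_norm_def)

lemma L2_norm_cong_AE:
  assumes "f \<in> borel_measurable M" "g \<in> borel_measurable M" "AE x in M. f x = g x"
  shows "L2_norm M f = L2_norm M g"
proof -
  have "(\<integral>x. (cmod (f x))\<^sup>2 \<partial>M) = (\<integral>x. (cmod (g x))\<^sup>2 \<partial>M)"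
    using assms by (intro integral_cong_AE) auto
  then show ?thesis by (simp add: L2_norm_def)
qed

lemma borel_measurable_cnj [measurable (raw)]:
  "f \<in> borel_measurable M \<Longrightarrow> (\<lambda>x. cnj (f x)) \<in> borel_measurable M"
  using measurable_compose[of f M borel cnj borel]
  by (simp add: borel_measurable_continuous_onI continuous_on_cnj)

lemma L2_inner_cong_AE:
  assumes "f \<in> borel_measurable M" "f' \<in> borel_measurable M" "g \<in> borel_measurable M"
    and "AE x in M. f x = f' x"
  shows "L2_inner M f g = L2_inner M f' g"
  unfolding L2_inner_def using assms by (intro integral_cong_AE) auto

lemma L2_norm_distr:
  assumes "\<phi> \<in> M \<rightarrow>\<^sub>M N" "h \<in> borel_measurable N"
  shows "L2_norm (distr M N \<phi>) h = L2_norm M (\<lambda>x. h (\<phi> x))"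
  unfolding L2_norm_def using assms by (subst integral_distr) auto

lemma L2_inner_distr:
  assumes "\<phi> \<in> M \<rightarrow>\<^sub>M N" "h \<in> borel_measurable N" "k \<in> borel_measurable N"
  shows "L2_inner (distr M N \<phi>) h k = L2_inner M (\<lambda>x. h (\<phi> x)) (\<lambda>x. k (\<phi> x))"
  unfolding L2_inner_def using assms by (subst integral_distr) auto

lemma L2_distr_iff:
  assumes "\<phi> \<in> M \<rightarrow>\<^sub>M N" "h \<in> borel_measurable N"
  shows "h \<in> L2 (distr M N \<phi>) \<longleftrightarrow> (\<lambda>x. h (\<phi> x)) \<in> L2 M"
  unfolding L2_def using assms by (auto simp: integrable_distr_eq)

lemma L2_add:
  assumes "f \<in> L2 M" "g \<in> L2 M"
  shows "(\<lambda>x. f x + g x) \<in> L2 M"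
proof -
  note [measurable] = L2_measurable[OF assms(1)] L2_measurable[OF assms(2)]
  have bound: "integrable M (\<lambda>x. 2 * (cmod (f x))\<^sup>2 + 2 * (cmod (g x))\<^sup>2)"
    using assms[THEN L2_integrable] by simp
  have "integrable M (\<lambda>x. (cmod (f x + g x))\<^sup>2)"
  proof (rule Bochner_Integration.integrable_bound[OF bound])
    have "(cmod (a + b))\<^sup>2 \<le> 2 * (cmod a)\<^sup>2 + 2 * (cmod b)\<^sup>2" for a b
    proof -
      have "(cmod (a + b))\<^sup>2 \<le> (cmod a + cmod b)\<^sup>2"
        by (intro power_mono norm_triangle_ineq) simp
      also have "\<dots> \<le> 2 * (cmod a)\<^sup>2 + 2 * (cmod b)\<^sup>2"
        using sum_squares_bound[of "cmod a" "cmod b"] by (simp add: power2_sum)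
      finally show ?thesis .
    qed
    then show "AE x in M. norm ((cmod (f x + g x))\<^sup>2) \<le> norm (2 * (cmod (f x))\<^sup>2 + 2 * (cmod (g x))\<^sup>2)"
      by simp
  qed simp
  then show ?thesis by (simp add: L2_def)
qed

lemma L2_cmult: "f \<in> L2 M \<Longrightarrow> (\<lambda>x. c * f x) \<in> L2 M"
  by (auto simp: L2_def norm_mult power_mult_distrib)

lemma L2_sum: "finite F \<Longrightarrow> (\<And>i. i \<in> F \<Longrightarrow> f i \<in> L2 M) \<Longrightarrow> (\<lambda>x. \<Sum>i\<in>F. f i x) \<in> L2 M"
proof (induction F rule: finite_induct)
  case empty
  then show ?case by (simp add: L2_def)
next
  case (insert i F)
  then show ?case using L2_add[of "f i" M "\<lambda>x. \<Sum>i\<in>F. f i x"] by simp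
qed

lemma L2_diff: "f \<in> L2 M \<Longrightarrow> g \<in> L2 M \<Longrightarrow> (\<lambda>x. f x - g x) \<in> L2 M"
  using L2_add[of f M "\<lambda>x. - 1 * g x"] L2_cmult[of g M "- 1"] by simp

text \<open>Orthogonality holds because composition with \<open>\<phi>\<close> preserves inner products. Essential injectivity enters in the
density: a function on \<open>M\<close> is first rewritten as \<open>h \<circ> \<phi>\<close>, and \<open>h\<close> is approximated on the other side.\<close>

lemma orthogonal_basis_L2_distr:
  assumes \<phi> [measurable]: "\<phi> \<in> borel_measurable M"
    and inj: "ess_injective M \<phi>"
    and basis: "orthogonal_basis_L2 (distr M borel \<phi>) I e"
  shows "orthogonal_basis_L2 M I (\<lambda>i x. e i (\<phi> x))"
  unfolding orthogonal_basis_L2_def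
proof (intro conjI ballI allI impI)
  let ?N = "distr M borel \<phi>"
  have e: "e i \<in> L2 ?N" and norm_e: "L2_norm ?N (e i) \<noteq> 0" if "i \<in> I" for i
    using basis that by (auto simp: orthogonal_basis_L2_def)
  have e_meas [measurable]: "e i \<in> borel_measurable borel" if "i \<in> I" for i
    using L2_measurable[OF e[OF that]] by simp
  show "(\<lambda>x. e i (\<phi> x)) \<in> L2 M" "L2_norm M (\<lambda>x. e i (\<phi> x)) \<noteq> 0" if "i \<in> I" for i
    using e[OF that] norm_e[OF that] e_meas[OF that] by (simp_all add: L2_distr_iff L2_norm_distr)
  show "L2_inner M (\<lambda>x. e i (\<phi> x)) (\<lambda>x. e j (\<phi> x)) = 0" if "i \<in> I" "j \<in> I" "i \<noteq> j" for i j
    using basis that e_meas by (simp add: orthogonal_basis_L2_def L2_inner_distr)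
  fix f :: "'a \<Rightarrow> complex" and \<epsilon> :: real
  assume f: "f \<in> L2 M" and "0 < \<epsilon>"
  obtain h where h: "h \<in> L2 ?N" and fh: "AE x in M. f x = h (\<phi> x)"
    using inj f unfolding ess_injective_def by blast
  obtain F c where F: "finite F" "F \<subseteq> I"
    and less: "L2_norm ?N (\<lambda>y. h y - (\<Sum>i\<in>F. c i * e i y)) < \<epsilon>"
    using basis h \<open>0 < \<epsilon>\<close> unfolding orthogonal_basis_L2_def by blast
  have [measurable]: "f \<in> borel_measurable M" "h \<in> borel_measurable borel"
    using L2_measurable[OF f] L2_measurable[OF h] by simp_all
  have [measurable]: "(\<lambda>y. \<Sum>i\<in>F. c i * e i y) \<in> borel_measurable borel"
    using F e_meas by (intro borel_measurable_sum borel_measurable_times) auto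
  have [measurable]: "(\<lambda>x. \<Sum>i\<in>F. c i * e i (\<phi> x)) \<in> borel_measurable M"
    using F e_meas \<phi> by (intro borel_measurable_sum borel_measurable_times) auto
  have "L2_norm M (\<lambda>x. f x - (\<Sum>i\<in>F. c i * e i (\<phi> x)))
      = L2_norm M (\<lambda>x. h (\<phi> x) - (\<Sum>i\<in>F. c i * e i (\<phi> x)))"
    using fh by (intro L2_norm_cong_AE) auto
  also have "\<dots> = L2_norm ?N (\<lambda>y. h y - (\<Sum>i\<in>F. c i * e i y))"
    by (subst L2_norm_distr) auto
  finally show "\<exists>F c. finite F \<and> F \<subseteq> I \<and> L2_norm M (\<lambda>x. f x - (\<Sum>i\<in>F. c i * e i (\<phi> x))) < \<epsilon>"
    using F less by (intro exI[of _ F] exI[of _ c]) simp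
qed

lemma frame_L2_distr:
  assumes \<phi> [measurable]: "\<phi> \<in> borel_measurable M"
    and inj: "ess_injective M \<phi>"
    and frame: "frame_L2 (distr M borel \<phi>) I e"
  shows "frame_L2 M I (\<lambda>i x. e i (\<phi> x))"
proof -
  let ?N = "distr M borel \<phi>"
  have "countable I" and e: "\<And>i. i \<in> I \<Longrightarrow> e i \<in> L2 ?N"
    using frame by (auto simp: frame_L2_def)
  have e_meas: "e i \<in> borel_measurable borel" if "i \<in> I" for i
    using L2_measurable[OF e[OF that]] by simp
  obtain A B where AB: "0 < A" "A \<le> B"
    and bounds: "\<And>h. h \<in> L2 ?N \<Longrightarrow> (\<lambda>i. (cmod (L2_inner ?N h (e i)))\<^sup>2) summable_on I \<and>
      A * (L2_norm ?N h)\<^sup>2 \<le> (\<Sum>\<^sub>\<infinity>i\<in>I. (cmod (L2_inner ?N h (e i)))\<^sup>2) \<and>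
      (\<Sum>\<^sub>\<infinity>i\<in>I. (cmod (L2_inner ?N h (e i)))\<^sup>2) \<le> B * (L2_norm ?N h)\<^sup>2"
    using frame unfolding frame_L2_def by blast
  have "(\<lambda>i. (cmod (L2_inner M f (\<lambda>x. e i (\<phi> x))))\<^sup>2) summable_on I \<and>
      A * (L2_norm M f)\<^sup>2 \<le> (\<Sum>\<^sub>\<infinity>i\<in>I. (cmod (L2_inner M f (\<lambda>x. e i (\<phi> x))))\<^sup>2) \<and>
      (\<Sum>\<^sub>\<infinity>i\<in>I. (cmod (L2_inner M f (\<lambda>x. e i (\<phi> x))))\<^sup>2) \<le> B * (L2_norm M f)\<^sup>2"
    if f: "f \<in> L2 M" for f
  proof -
    obtain h where h: "h \<in> L2 ?N" and fh: "AE x in M. f x = h (\<phi> x)"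
      using inj f unfolding ess_injective_def by blast
    have [measurable]: "f \<in> borel_measurable M" "h \<in> borel_measurable borel"
      using L2_measurable[OF f] L2_measurable[OF h] by simp_all
    have inner: "L2_inner ?N h (e i) = L2_inner M f (\<lambda>x. e i (\<phi> x))" if "i \<in> I" for i
    proof -
      note [measurable] = e_meas[OF that]
      show ?thesis
        using fh by (subst L2_inner_distr) (auto intro!: L2_inner_cong_AE)
    qed
    have norm: "L2_norm ?N h = L2_norm M f"
      using fh by (subst L2_norm_distr) (auto intro!: L2_norm_cong_AE)
    have "(\<lambda>i. (cmod (L2_inner ?N h (e i)))\<^sup>2) summable_on I
        \<longleftrightarrow> (\<lambda>i. (cmod (L2_inner M f (\<lambda>x. e i (\<phi> x))))\<^sup>2) summable_on I"
      by (intro summable_on_cong) (simp add: inner)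
    moreover have "(\<Sum>\<^sub>\<infinity>i\<in>I. (cmod (L2_inner ?N h (e i)))\<^sup>2)
        = (\<Sum>\<^sub>\<infinity>i\<in>I. (cmod (L2_inner M f (\<lambda>x. e i (\<phi> x))))\<^sup>2)"
      by (intro infsum_cong) (simp add: inner)
    ultimately show ?thesis
      using bounds[OF h] by (simp add: norm)
  qed
  moreover have "\<forall>i\<in>I. (\<lambda>x. e i (\<phi> x)) \<in> L2 M"
    using e e_meas by (simp add: L2_distr_iff)
  ultimately show ?thesis
    unfolding frame_L2_def using \<open>countable I\<close> AB by blast
qed

section \<open>Translation invariance and countable sums\<close>

lemma lebesgue_measurable_translation [measurable]:
  "(\<lambda>x. x + a) \<in> lebesgue \<rightarrow>\<^sub>M (lebesgue :: 'a::euclidean_space measure)"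
  using lebesgue_affine_measurable[of "\<lambda>_::'a. 1" a]
  by (simp add: euclidean_representation add.commute)

lemma distr_lebesgue_translation:
  "distr lebesgue lebesgue (\<lambda>x. x + a) = (lebesgue :: 'a::euclidean_space measure)"
  using lebesgue_affine_euclidean[of "\<lambda>_::'a. 1" a, symmetric]
  by (simp add: euclidean_representation add.commute density_1)

lemma integral_lebesgue_translation:
  fixes f :: "'a::euclidean_space \<Rightarrow> 'b::{banach, second_countable_topology}"
  assumes "f \<in> borel_measurable lebesgue"
  shows "(\<integral>x. f (x + a) \<partial>lebesgue) = (\<integral>x. f x \<partial>lebesgue)"
  using integral_distr[OF lebesgue_measurable_translation[of a] assms]
  by (simp add: distr_lebesgue_translation)

lemma integrable_lebesgue_translation:
  fixes f :: "'a::euclidean_space \<Rightarrow> 'b::{banach, second_countable_topology}"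
  assumes "f \<in> borel_measurable lebesgue"
  shows "integrable lebesgue (\<lambda>x. f (x + a)) \<longleftrightarrow> integrable lebesgue f"
  using integrable_distr_eq[OF lebesgue_measurable_translation[of a] assms]
  by (simp add: distr_lebesgue_translation)

lemma AE_lebesgue_translation:
  assumes "AE x in lebesgue. P x"
  shows "AE x in lebesgue. P (x + a :: 'a::euclidean_space)"
proof (rule AE_distrD[OF lebesgue_measurable_translation])
  show "AE x in distr lebesgue lebesgue (\<lambda>x. x + a). P x"
    using assms by (simp only: distr_lebesgue_translation)
qed

text \<open>The passage from Tonelli's theorem, which lives in the extended nonnegative reals, to unordered
sums of reals.\<close>

lemma has_sum_if_nn_integral_count_space:
  assumes nonneg: "\<And>i. i \<in> I \<Longrightarrow> 0 \<le> a i" and "0 \<le> S"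
    and S: "(\<integral>\<^sup>+i. ennreal (a i) \<partial>count_space I) = ennreal S"
  shows "(a has_sum S) I"
proof -
  have "integrable (count_space I) a"
    using nonneg S by (intro integrableI_nonneg) (auto simp: AE_count_space)
  then have summable: "Infinite_Set_Sum.abs_summable_on a I"
    by (simp add: Infinite_Set_Sum.abs_summable_on_def)
  then have "ennreal (infsetsum a I) = ennreal S"
    using nn_integral_conv_infsetsum[of a I] nonneg S by simp
  then have "infsetsum a I = S"
    using nonneg \<open>0 \<le> S\<close> by (simp add: infsetsum_nonneg)
  then have "infsum a I = S"
    by (simp add: infsetsum_infsum[OF summable])
  moreover have "a summable_on I"
    using summable abs_summable_equivalent abs_summable_summable by blast
  ultimately show ?thesis
    using has_sum_infsum by blast
qed

section \<open>Tilings by translates of a set\<close>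

definition tile_lift :: "'a::euclidean_space set \<Rightarrow> ('a \<Rightarrow> complex) \<Rightarrow> 'a \<Rightarrow> 'a \<Rightarrow> complex" where
  "tile_lift \<Omega> e \<gamma> s = e (s - \<gamma>) * indicator \<Omega> (s - \<gamma>)"

locale lebesgue_tiling =
  fixes \<Omega> \<Gamma> :: "'a::euclidean_space set"
  assumes sets_tile [measurable]: "\<Omega> \<in> sets lebesgue"
    and tile_pos: "0 < emeasure lebesgue \<Omega>"
    and tiles: "tiles \<Omega> \<Gamma>"
begin

lemma tile_Int_space [simp]: "\<Omega> \<inter> space lebesgue \<in> sets lebesgue"
  using sets_tile by simp

lemma in_translate_measurable [measurable]: "Measurable.pred lebesgue (\<lambda>s. s - \<gamma> \<in> \<Omega>)"
  using measurable_compose[OF lebesgue_measurable_translation[of "-\<gamma>"], of "\<lambda>s. s \<in> \<Omega>"] by simp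

lemma AE_overlap:
  assumes "countable F" "F \<subseteq> \<Gamma>"
  shows "AE s in lebesgue. \<forall>\<gamma>\<in>F. \<forall>\<gamma>'\<in>F. s - \<gamma> \<in> \<Omega> \<longrightarrow> s - \<gamma>' \<in> \<Omega> \<longrightarrow> \<gamma> = \<gamma>'"
proof -
  have "AE s in lebesgue. s - \<gamma> \<in> \<Omega> \<longrightarrow> s - \<gamma>' \<in> \<Omega> \<longrightarrow> \<gamma> = \<gamma>'" if "\<gamma> \<in> F" "\<gamma>' \<in> F" for \<gamma> \<gamma>'
  proof (cases "\<gamma> = \<gamma>'")
    case False
    have "(\<lambda>x. x + \<gamma>) ` \<Omega> \<inter> (\<lambda>x. x + \<gamma>') ` \<Omega> \<in> null_sets lebesgue"
      using tiles that assms False unfolding tiles_def by blast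
    moreover have "{s \<in> space lebesgue. \<not> (s - \<gamma> \<in> \<Omega> \<longrightarrow> s - \<gamma>' \<in> \<Omega> \<longrightarrow> \<gamma> = \<gamma>')}
        \<subseteq> (\<lambda>x. x + \<gamma>) ` \<Omega> \<inter> (\<lambda>x. x + \<gamma>') ` \<Omega>"
      by (auto simp: image_iff) (metis diff_add_cancel)+
    ultimately show ?thesis by (rule AE_I')
  qed simp
  then show ?thesis
    by (intro AE_ball_countable' assms)
qed

text \<open>Weigh the space by a strictly positive integrable function \<open>w\<close>. Every tile has positive measure and
so gets positive weight, while the almost disjointness bounds all finite sums of these weights by the
integral of \<open>w\<close>. A summable family has only countably many nonzero members.\<close>

lemma countable_translations: "countable \<Gamma>"
proof -
  obtain w :: "'a \<Rightarrow> real" where w: "w \<in> borel_measurable lborel" "\<And>x. w x > 0" "\<And>x. w x \<le> 1" "integrable lborel w"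
    by (rule sigma_finite_measure.obtain_positive_integrable_function[OF lborel.sigma_finite_measure_axioms])
      (rule that; simp)
  then have int_w: "integrable lebesgue w"
    by (simp add: integrable_completion)
  then have [measurable]: "w \<in> borel_measurable lebesgue"
    by simp
  define a where "a \<gamma> = (\<integral>s. w s * indicator \<Omega> (s - \<gamma>) \<partial>lebesgue)" for \<gamma>
  have meas: "(\<lambda>s. w s * indicator \<Omega> (s - \<gamma>)) \<in> borel_measurable lebesgue" for \<gamma>
    unfolding indicator_def by measurable
  have int: "integrable lebesgue (\<lambda>s. w s * indicator \<Omega> (s - \<gamma>))" for \<gamma>
    by (rule Bochner_Integration.integrable_bound[OF int_w meas]) (auto simp: indicator_def)
  have nonneg: "0 \<le> a \<gamma>" for \<gamma>
    unfolding a_def using w(2) by (intro integral_nonneg_AE) (auto simp: less_imp_le)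
  have nonzero: "a \<gamma> \<noteq> 0" for \<gamma>
  proof
    assume "a \<gamma> = 0"
    then have "AE s in lebesgue. w s * indicator \<Omega> (s - \<gamma>) = 0"
      using integral_nonneg_eq_0_iff_AE[OF int] w(2) by (simp add: a_def less_imp_le)
    then have "AE s in lebesgue. w (s + \<gamma>) * indicator \<Omega> (s + \<gamma> - \<gamma>) = 0"
      by (rule AE_lebesgue_translation)
    then have "AE s in lebesgue. s \<notin> \<Omega>"
      using w(2) by (auto simp: indicator_def less_imp_neq[symmetric] split: if_splits elim!: eventually_mono)
    then have "emeasure lebesgue \<Omega> = 0"
      using AE_iff_null_sets[OF sets_tile] by auto
    then show False using tile_pos by simp
  qed
  have "sum a F \<le> (\<integral>s. w s \<partial>lebesgue)" if "finite F" "F \<subseteq> \<Gamma>" for F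
  proof -
    have "sum a F = (\<integral>s. (\<Sum>\<gamma>\<in>F. w s * indicator \<Omega> (s - \<gamma>)) \<partial>lebesgue)"
      unfolding a_def using int by (intro Bochner_Integration.integral_sum[symmetric])
    also have "\<dots> \<le> (\<integral>s. w s \<partial>lebesgue)"
    proof (rule integral_mono_AE)
      show "AE s in lebesgue. (\<Sum>\<gamma>\<in>F. w s * indicator \<Omega> (s - \<gamma>)) \<le> w s"
        using AE_overlap[OF countable_finite[OF that(1)] that(2)]
      proof eventually_elim
        case (elim s)
        show ?case
        proof (cases "\<exists>\<gamma>\<in>F. s - \<gamma> \<in> \<Omega>")
          case True
          then obtain \<gamma>0 where "\<gamma>0 \<in> F" "s - \<gamma>0 \<in> \<Omega>" by blast
          have "(\<Sum>\<gamma>\<in>F. w s * indicator \<Omega> (s - \<gamma>)) = (\<Sum>\<gamma>\<in>F. if \<gamma> = \<gamma>0 then w s else 0)"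
            using elim \<open>\<gamma>0 \<in> F\<close> \<open>s - \<gamma>0 \<in> \<Omega>\<close> by (intro sum.cong) (auto simp: indicator_def)
          also have "\<dots> = w s"
            using \<open>finite F\<close> \<open>\<gamma>0 \<in> F\<close> by simp
          finally show ?thesis by (rule eq_refl)
        next
          case False
          then have "(\<Sum>\<gamma>\<in>F. w s * indicator \<Omega> (s - \<gamma>)) = 0"
            by (intro sum.neutral) (auto simp: indicator_def)
          also have "\<dots> \<le> w s"
            using w(2)[of s] by simp
          finally show ?thesis .
        qed
      qed
    qed (use int int_w in auto)
    finally show ?thesis .
  qed
  then have "a summable_on \<Gamma>"
    using nonneg by (intro nonneg_bdd_above_summable_on bdd_aboveI2[where M="\<integral>s. w s \<partial>lebesgue"]) auto
  then have "countable {\<gamma>\<in>\<Gamma>. a \<gamma> \<noteq> 0}"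
    by (rule summable_countable_real)
  then show ?thesis using nonzero by simp
qed

lemma AE_unique_tile: "AE s in lebesgue. \<exists>\<gamma>\<in>\<Gamma>. \<forall>\<gamma>'\<in>\<Gamma>. s - \<gamma>' \<in> \<Omega> \<longleftrightarrow> \<gamma>' = \<gamma>"
  using AE_overlap[OF countable_translations subset_refl]
proof eventually_elim
  case (elim s)
  have "s \<in> (\<Union>\<gamma>\<in>\<Gamma>. (\<lambda>x. x + \<gamma>) ` \<Omega>)"
    using tiles by (simp add: tiles_def)
  then obtain \<gamma> where "\<gamma> \<in> \<Gamma>" "s - \<gamma> \<in> \<Omega>" by auto
  with elim show ?case by blast
qed

text \<open>Almost every point lies in exactly one tile, so inserting the indicator functions of the tiles does
not change \<open>g\<close>; Tonelli's theorem then exchanges the sum with the integral, and each tile is moved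
back to \<open>\<Omega>\<close> by translation invariance.\<close>

lemma has_sum_integral_tiles:
  fixes g :: "'a \<Rightarrow> real"
  assumes int: "integrable lebesgue g" and nonneg: "\<And>s. 0 \<le> g s"
  shows "((\<lambda>\<gamma>. \<integral>s. g (s + \<gamma>) \<partial>lebesgue_on \<Omega>) has_sum (\<integral>s. g s \<partial>lebesgue)) \<Gamma>"
proof (rule has_sum_if_nn_integral_count_space)
  have [measurable]: "g \<in> borel_measurable lebesgue"
    using int by simp
  have meas: "(\<lambda>s. ennreal (g s) * indicator \<Omega> (s - \<gamma>)) \<in> borel_measurable lebesgue" for \<gamma>
    unfolding indicator_def by measurable
  have tile: "(\<integral>\<^sup>+s. ennreal (g s) * indicator \<Omega> (s - \<gamma>) \<partial>lebesgue)
      = ennreal (\<integral>s. g (s + \<gamma>) \<partial>lebesgue_on \<Omega>)" for \<gamma>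
  proof -
    have shift: "integrable lebesgue (\<lambda>s. g (s + \<gamma>))"
      using int by (simp add: integrable_lebesgue_translation)
    then have int': "integrable (lebesgue_on \<Omega>) (\<lambda>s. g (s + \<gamma>))"
      using integrable_mult_indicator[OF sets_tile shift] by (simp add: integrable_restrict_space)
    have "(\<integral>\<^sup>+s. ennreal (g s) * indicator \<Omega> (s - \<gamma>) \<partial>lebesgue)
        = (\<integral>\<^sup>+s. ennreal (g s) * indicator \<Omega> (s - \<gamma>) \<partial>distr lebesgue lebesgue (\<lambda>s. s + \<gamma>))"
      by (simp add: distr_lebesgue_translation)
    also have "\<dots> = (\<integral>\<^sup>+s. ennreal (g (s + \<gamma>)) * indicator \<Omega> s \<partial>lebesgue)"
      by (subst nn_integral_distr[OF lebesgue_measurable_translation]) (use meas in simp_all)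
    also have "\<dots> = (\<integral>\<^sup>+s. ennreal (g (s + \<gamma>)) \<partial>lebesgue_on \<Omega>)"
      by (simp add: nn_integral_restrict_space)
    also have "\<dots> = ennreal (\<integral>s. g (s + \<gamma>) \<partial>lebesgue_on \<Omega>)"
      using int' nonneg by (intro nn_integral_eq_integral) auto
    finally show ?thesis .
  qed
  have "ennreal (\<integral>s. g s \<partial>lebesgue) = (\<integral>\<^sup>+s. ennreal (g s) \<partial>lebesgue)"
    using int nonneg by (intro nn_integral_eq_integral[symmetric]) auto
  also have "\<dots> = (\<integral>\<^sup>+s. \<integral>\<^sup>+\<gamma>. ennreal (g s) * indicator \<Omega> (s - \<gamma>) \<partial>count_space \<Gamma> \<partial>lebesgue)"
  proof (rule nn_integral_cong_AE)
    show "AE s in lebesgue. ennreal (g s) = (\<integral>\<^sup>+\<gamma>. ennreal (g s) * indicator \<Omega> (s - \<gamma>) \<partial>count_space \<Gamma>)"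
      using AE_unique_tile
    proof eventually_elim
      case (elim s)
      then obtain \<gamma>0 where "\<gamma>0 \<in> \<Gamma>" and unique: "\<And>\<gamma>. \<gamma> \<in> \<Gamma> \<Longrightarrow> s - \<gamma> \<in> \<Omega> \<longleftrightarrow> \<gamma> = \<gamma>0"
        by blast
      have "(\<integral>\<^sup>+\<gamma>. ennreal (g s) * indicator \<Omega> (s - \<gamma>) \<partial>count_space \<Gamma>)
          = (\<integral>\<^sup>+\<gamma>. ennreal (g s) * indicator {\<gamma>0} \<gamma> \<partial>count_space \<Gamma>)"
        using unique by (intro nn_integral_cong) (auto simp: indicator_def)
      also have "\<dots> = ennreal (g s)"
        using \<open>\<gamma>0 \<in> \<Gamma>\<close> by (subst nn_integral_cmult_indicator) auto
      finally show ?case by simp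
    qed
  qed
  also have "\<dots> = (\<integral>\<^sup>+\<gamma>. ennreal (\<integral>s. g (s + \<gamma>) \<partial>lebesgue_on \<Omega>) \<partial>count_space \<Gamma>)"
    by (subst nn_integral_count_space_nn_integral[OF countable_translations meas]) (simp add: tile)
  finally show "(\<integral>\<^sup>+\<gamma>. ennreal (\<integral>s. g (s + \<gamma>) \<partial>lebesgue_on \<Omega>) \<partial>count_space \<Gamma>)
      = ennreal (\<integral>s. g s \<partial>lebesgue)" by simp
qed (use nonneg in \<open>auto intro!: integral_nonneg_AE\<close>)

lemma tile_lift_altdef: "tile_lift \<Omega> e \<gamma> s = indicator \<Omega> (s - \<gamma>) *\<^sub>R e (s - \<gamma>)"
  by (simp add: tile_lift_def indicator_def)

lemma tile_lift_measurable:
  assumes "e \<in> borel_measurable (lebesgue_on \<Omega>)"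
  shows "tile_lift \<Omega> e \<gamma> \<in> borel_measurable lebesgue"
proof -
  have "(\<lambda>s. indicator \<Omega> s *\<^sub>R e s) \<in> borel_measurable lebesgue"
    using assms borel_measurable_restrict_space_iff[OF tile_Int_space] by blast
  from measurable_compose[OF lebesgue_measurable_translation[of "-\<gamma>"] this]
  show ?thesis
    unfolding tile_lift_altdef[abs_def] by simp
qed

lemma shift_L2:
  assumes "f \<in> L2 lebesgue"
  shows "(\<lambda>s. f (s + \<gamma>)) \<in> L2 (lebesgue_on \<Omega>)"
proof -
  note [measurable] = L2_measurable[OF assms]
  have shift: "(\<lambda>s. f (s + \<gamma>)) \<in> borel_measurable lebesgue"
    by (rule measurable_compose[OF lebesgue_measurable_translation]) simp
  have "integrable lebesgue (\<lambda>s. (cmod (f (s + \<gamma>)))\<^sup>2)"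
    using integrable_lebesgue_translation[of "\<lambda>s. (cmod (f s))\<^sup>2" \<gamma>] L2_integrable[OF assms] by simp
  then have "integrable (lebesgue_on \<Omega>) (\<lambda>s. (cmod (f (s + \<gamma>)))\<^sup>2)"
    using integrable_mult_indicator[OF sets_tile, of "\<lambda>s. (cmod (f (s + \<gamma>)))\<^sup>2"]
    by (simp add: integrable_restrict_space)
  then show ?thesis
    using measurable_restrict_space1[OF shift] by (simp add: L2_def)
qed

lemma L2_inner_tile_lift:
  assumes f: "f \<in> borel_measurable lebesgue" and e: "e \<in> borel_measurable (lebesgue_on \<Omega>)"
  shows "L2_inner lebesgue f (tile_lift \<Omega> e \<gamma>) = L2_inner (lebesgue_on \<Omega>) (\<lambda>s. f (s + \<gamma>)) e"
proof -
  have "L2_inner lebesgue f (tile_lift \<Omega> e \<gamma>)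
      = (\<integral>s. f (s + \<gamma>) * cnj (tile_lift \<Omega> e \<gamma> (s + \<gamma>)) \<partial>lebesgue)"
    unfolding L2_inner_def
    by (intro integral_lebesgue_translation[symmetric] borel_measurable_times borel_measurable_cnj
        f tile_lift_measurable[OF e])
  also have "\<dots> = (\<integral>s. indicator \<Omega> s *\<^sub>R (f (s + \<gamma>) * cnj (e s)) \<partial>lebesgue)"
    by (intro Bochner_Integration.integral_cong) (auto simp: tile_lift_def indicator_def)
  also have "\<dots> = L2_inner (lebesgue_on \<Omega>) (\<lambda>s. f (s + \<gamma>)) e"
    by (simp add: L2_inner_def integral_restrict_space)
  finally show ?thesis .
qed

lemma tile_lift_L2:
  assumes e: "e \<in> L2 (lebesgue_on \<Omega>)"
  shows "tile_lift \<Omega> e \<gamma> \<in> L2 lebesgue"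
proof -
  note meas [measurable] = tile_lift_measurable[OF L2_measurable[OF e], of \<gamma>]
  have "integrable lebesgue (\<lambda>s. indicator \<Omega> s *\<^sub>R (cmod (e s))\<^sup>2)"
    using L2_integrable[OF e] by (simp add: integrable_restrict_space)
  also have "(\<lambda>s. indicator \<Omega> s *\<^sub>R (cmod (e s))\<^sup>2) = (\<lambda>s. (cmod (tile_lift \<Omega> e \<gamma> (s + \<gamma>)))\<^sup>2)"
    by (auto simp: tile_lift_def indicator_def)
  finally have "integrable lebesgue (\<lambda>s. (cmod (tile_lift \<Omega> e \<gamma> s))\<^sup>2)"
    using integrable_lebesgue_translation[of "\<lambda>s. (cmod (tile_lift \<Omega> e \<gamma> s))\<^sup>2" \<gamma>] by simp
  then show ?thesis
    using meas by (simp add: L2_def)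
qed

lemma L2_norm_tile_lift:
  assumes e: "e \<in> borel_measurable (lebesgue_on \<Omega>)"
  shows "L2_norm lebesgue (tile_lift \<Omega> e \<gamma>) = L2_norm (lebesgue_on \<Omega>) e"
proof -
  note [measurable] = tile_lift_measurable[OF e, of \<gamma>]
  have "(\<integral>s. (cmod (tile_lift \<Omega> e \<gamma> s))\<^sup>2 \<partial>lebesgue)
      = (\<integral>s. (cmod (tile_lift \<Omega> e \<gamma> (s + \<gamma>)))\<^sup>2 \<partial>lebesgue)"
    by (intro integral_lebesgue_translation[symmetric]) measurable
  also have "\<dots> = (\<integral>s. indicator \<Omega> s *\<^sub>R (cmod (e s))\<^sup>2 \<partial>lebesgue)"
    by (intro Bochner_Integration.integral_cong) (auto simp: tile_lift_def indicator_def)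
  also have "\<dots> = (\<integral>s. (cmod (e s))\<^sup>2 \<partial>lebesgue_on \<Omega>)"
    by (simp add: integral_restrict_space)
  finally show ?thesis by (simp add: L2_norm_def)
qed

text \<open>The pieces of \<open>f\<close> on different tiles have almost disjoint supports, so their squared norms add up;
each of them is measured after moving it back to \<open>\<Omega>\<close>.\<close>

lemma has_sum_L2_norm_tiles:
  assumes "f \<in> L2 lebesgue"
  shows "((\<lambda>\<gamma>. (L2_norm (lebesgue_on \<Omega>) (\<lambda>s. f (s + \<gamma>)))\<^sup>2) has_sum (L2_norm lebesgue f)\<^sup>2) \<Gamma>"
  unfolding L2_norm_sq by (rule has_sum_integral_tiles[OF L2_integrable[OF assms]]) simp

lemma L2_inner_tile_lift_distinct:
  assumes "\<gamma> \<in> \<Gamma>" "\<gamma>' \<in> \<Gamma>" "\<gamma> \<noteq> \<gamma>'"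
  shows "L2_inner lebesgue (tile_lift \<Omega> e \<gamma>) (tile_lift \<Omega> e' \<gamma>') = 0"
  unfolding L2_inner_def
proof (rule integral_eq_zero_AE)
  show "AE s in lebesgue. tile_lift \<Omega> e \<gamma> s * cnj (tile_lift \<Omega> e' \<gamma>' s) = 0"
    using AE_overlap[OF countable_translations subset_refl]
    by eventually_elim (use assms in \<open>auto simp: tile_lift_def indicator_def\<close>)
qed

text \<open>Seen from a single tile, a combination of lifted functions reduces to the terms that live on it.\<close>

lemma AE_combination_on_tile:
  assumes F: "finite F" "F \<subseteq> \<Gamma>" and "\<gamma> \<in> \<Gamma>"
  shows "AE s in lebesgue_on \<Omega>. (\<Sum>(i, \<gamma>')\<in>G \<times> F. c i \<gamma>' * tile_lift \<Omega> (e i) \<gamma>' (s + \<gamma>))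
      = (if \<gamma> \<in> F then \<Sum>i\<in>G. c i \<gamma> * e i s else 0)"
proof -
  have "AE s in lebesgue. s \<in> \<Omega> \<longrightarrow> (\<forall>\<gamma>'\<in>\<Gamma>. s + \<gamma> - \<gamma>' \<in> \<Omega> \<longrightarrow> \<gamma>' = \<gamma>)"
    using AE_lebesgue_translation[OF AE_overlap[OF countable_translations subset_refl], of \<gamma>]
    by eventually_elim (use \<open>\<gamma> \<in> \<Gamma>\<close> in auto)
  then show ?thesis
    unfolding AE_restrict_space_iff[OF tile_Int_space]
  proof eventually_elim
    case (elim s)
    show ?case
    proof
      assume "s \<in> \<Omega>"
      then have lift: "tile_lift \<Omega> (e i) \<gamma>' (s + \<gamma>) = (if \<gamma>' = \<gamma> then e i s else 0)" if "\<gamma>' \<in> F" for i \<gamma>'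
        using elim that F(2) by (auto simp: tile_lift_def indicator_def)
      have "(\<Sum>(i, \<gamma>')\<in>G \<times> F. c i \<gamma>' * tile_lift \<Omega> (e i) \<gamma>' (s + \<gamma>))
          = (\<Sum>i\<in>G. \<Sum>\<gamma>'\<in>F. if \<gamma>' = \<gamma> then c i \<gamma> * e i s else 0)"
        unfolding sum.cartesian_product[symmetric] using lift by (intro sum.cong) auto
      also have "\<dots> = (if \<gamma> \<in> F then \<Sum>i\<in>G. c i \<gamma> * e i s else 0)"
        using F(1) by simp
      finally show "(\<Sum>(i, \<gamma>')\<in>G \<times> F. c i \<gamma>' * tile_lift \<Omega> (e i) \<gamma>' (s + \<gamma>))
          = (if \<gamma> \<in> F then \<Sum>i\<in>G. c i \<gamma> * e i s else 0)" .
    qed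
  qed
qed

text \<open>For the density, let \<open>F\<close> be a finite set of tiles outside of which \<open>f\<close> has small norm, and approximate
\<open>f\<close> on each tile in \<open>F\<close> by a combination of the given basis. The squared error of the sum of the lifted
combinations is the sum of the squared errors over \<open>F\<close> plus the mass of \<open>f\<close> outside \<open>F\<close>. Orthogonality
is inherited on one tile and due to almost disjoint supports on different ones.\<close>

lemma orthogonal_basis_L2_tile_lift:
  assumes basis: "orthogonal_basis_L2 (lebesgue_on \<Omega>) I e"
  shows "orthogonal_basis_L2 lebesgue (I \<times> \<Gamma>) (\<lambda>(i, \<gamma>). tile_lift \<Omega> (e i) \<gamma>)"
proof -
  let ?N = "lebesgue_on \<Omega>"
  let ?E = "\<lambda>(i, \<gamma>). tile_lift \<Omega> (e i) \<gamma>"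
  have e: "e i \<in> L2 ?N" and e_norm: "L2_norm ?N (e i) \<noteq> 0" if "i \<in> I" for i
    using basis that by (auto simp: orthogonal_basis_L2_def)
  have tile_total: "\<exists>G c. finite G \<and> G \<subseteq> I \<and> L2_norm ?N (\<lambda>s. h s - (\<Sum>i\<in>G. c i * e i s)) < \<delta>"
    if "h \<in> L2 ?N" "0 < \<delta>" for h and \<delta> :: real
    using basis that by (simp add: orthogonal_basis_L2_def)
  have inner: "L2_inner lebesgue (tile_lift \<Omega> (e i) \<gamma>) (tile_lift \<Omega> (e j) \<gamma>') = 0"
    if "i \<in> I" "j \<in> I" "\<gamma> \<in> \<Gamma>" "\<gamma>' \<in> \<Gamma>" "(i, \<gamma>) \<noteq> (j, \<gamma>')" for i j \<gamma> \<gamma>'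
  proof (cases "\<gamma> = \<gamma>'")
    case True
    have "L2_inner lebesgue (tile_lift \<Omega> (e i) \<gamma>) (tile_lift \<Omega> (e j) \<gamma>)
        = L2_inner ?N (\<lambda>s. tile_lift \<Omega> (e i) \<gamma> (s + \<gamma>)) (e j)"
      using that e by (intro L2_inner_tile_lift tile_lift_measurable L2_measurable) auto
    also have "\<dots> = L2_inner ?N (e i) (e j)"
      unfolding L2_inner_def by (intro Bochner_Integration.integral_cong) (auto simp: tile_lift_def)
    also have "\<dots> = 0"
      using basis that True by (auto simp: orthogonal_basis_L2_def)
    finally show ?thesis using True by simp
  qed (use that L2_inner_tile_lift_distinct in auto)
  have total: "\<exists>P c. finite P \<and> P \<subseteq> I \<times> \<Gamma> \<and> L2_norm lebesgue (\<lambda>s. f s - (\<Sum>p\<in>P. c p * ?E p s)) < \<epsilon>"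
    if f: "f \<in> L2 lebesgue" and "0 < \<epsilon>" for f and \<epsilon> :: real
  proof -
    define n where "n \<gamma> = (L2_norm ?N (\<lambda>s. f (s + \<gamma>)))\<^sup>2" for \<gamma>
    have n: "(n has_sum (L2_norm lebesgue f)\<^sup>2) \<Gamma>"
      unfolding n_def by (rule has_sum_L2_norm_tiles[OF f])
    obtain F where F: "finite F" "F \<subseteq> \<Gamma>" and tail: "dist (sum n F) ((L2_norm lebesgue f)\<^sup>2) \<le> \<epsilon>\<^sup>2 / 4"
      using has_sum_finite_approximation[OF n, of "\<epsilon>\<^sup>2 / 4"] \<open>0 < \<epsilon>\<close> by auto
    \<comment> \<open>Small enough that \<open>card F\<close> errors of size \<open>\<delta>\<^sup>2\<close> stay below \<open>\<epsilon>\<^sup>2 / 2\<close>; adding 1 covers \<open>F = {}\<close>.\<close>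
    define \<delta> where "\<delta> = \<epsilon> / sqrt (2 * (real (card F) + 1))"
    have "0 < \<delta>" and \<delta>_sq: "\<delta>\<^sup>2 = \<epsilon>\<^sup>2 / (2 * (real (card F) + 1))"
      using \<open>0 < \<epsilon>\<close> by (simp_all add: \<delta>_def power_divide)
    let ?approx = "\<lambda>\<gamma> G c. finite G \<and> G \<subseteq> I \<and> L2_norm ?N (\<lambda>s. f (s + \<gamma>) - (\<Sum>i\<in>G. c i * e i s)) < \<delta>"
    have "\<forall>\<gamma>. \<exists>G c. ?approx \<gamma> G c"
      by (intro allI tile_total[OF shift_L2[OF f] \<open>0 < \<delta>\<close>])
    from choice[OF this] obtain G where "\<forall>\<gamma>. \<exists>c. ?approx \<gamma> (G \<gamma>) c"
      by (rule exE)
    from choice[OF this] obtain c where Gc: "\<forall>\<gamma>. ?approx \<gamma> (G \<gamma>) (c \<gamma>)"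
      by (rule exE)
    have G: "finite (G \<gamma>)" "G \<gamma> \<subseteq> I"
      and approx: "L2_norm ?N (\<lambda>s. f (s + \<gamma>) - (\<Sum>i\<in>G \<gamma>. c \<gamma> i * e i s)) < \<delta>" for \<gamma>
      using spec[OF Gc, of \<gamma>] by simp_all
    \<comment> \<open>A common index set for all tiles, with zero coefficients where a tile does not use an index.\<close>
    define G' where "G' = (\<Union>\<gamma>\<in>F. G \<gamma>)"
    define c' where "c' i \<gamma> = (if i \<in> G \<gamma> then c \<gamma> i else 0)" for i \<gamma>
    have G': "finite G'" "G' \<subseteq> I"
      using F G by (auto simp: G'_def)
    define g where "g s = (\<Sum>(i, \<gamma>)\<in>G' \<times> F. c' i \<gamma> * tile_lift \<Omega> (e i) \<gamma> s)" for s
    have g: "g \<in> L2 lebesgue"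
      unfolding g_def[abs_def] using G' F e
      by (intro L2_sum) (auto intro!: L2_cmult tile_lift_L2)
    define m where "m \<gamma> = (L2_norm ?N (\<lambda>s. f (s + \<gamma>) - g (s + \<gamma>)))\<^sup>2" for \<gamma>
    have m: "(m has_sum (L2_norm lebesgue (\<lambda>s. f s - g s))\<^sup>2) \<Gamma>"
      unfolding m_def by (rule has_sum_L2_norm_tiles[OF L2_diff[OF f g]])
    have restrict: "L2_norm ?N (\<lambda>s. f (s + \<gamma>) - g (s + \<gamma>))
        = L2_norm ?N (\<lambda>s. f (s + \<gamma>) - (if \<gamma> \<in> F then \<Sum>i\<in>G'. c' i \<gamma> * e i s else 0))" if "\<gamma> \<in> \<Gamma>" for \<gamma>
    proof (rule L2_norm_cong_AE)
      have "(\<lambda>s. \<Sum>i\<in>G'. c' i \<gamma> * e i s) \<in> L2 ?N"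
        using G' e by (intro L2_sum L2_cmult) auto
      moreover have "(\<lambda>s. 0) \<in> L2 ?N"
        by (simp add: L2_def)
      ultimately have "(\<lambda>s. if \<gamma> \<in> F then \<Sum>i\<in>G'. c' i \<gamma> * e i s else 0) \<in> L2 ?N"
        by (cases "\<gamma> \<in> F") simp_all
      then show "(\<lambda>s. f (s + \<gamma>) - (if \<gamma> \<in> F then \<Sum>i\<in>G'. c' i \<gamma> * e i s else 0)) \<in> borel_measurable ?N"
        by (intro L2_measurable L2_diff shift_L2[OF f])
      show "(\<lambda>s. f (s + \<gamma>) - g (s + \<gamma>)) \<in> borel_measurable ?N"
        by (intro L2_measurable L2_diff shift_L2 f g)
      show "AE s in ?N. f (s + \<gamma>) - g (s + \<gamma>)
          = f (s + \<gamma>) - (if \<gamma> \<in> F then \<Sum>i\<in>G'. c' i \<gamma> * e i s else 0)"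
        using AE_combination_on_tile[OF F that, of c' e G'] by (simp add: g_def)
    qed
    have m_less: "m \<gamma> \<le> \<delta>\<^sup>2" if "\<gamma> \<in> F" for \<gamma>
    proof -
      have "(\<Sum>i\<in>G'. c' i \<gamma> * e i s) = (\<Sum>i\<in>G \<gamma>. c \<gamma> i * e i s)" for s
        using G'(1) that by (intro sum.mono_neutral_cong_right) (auto simp: G'_def c'_def)
      then have "L2_norm ?N (\<lambda>s. f (s + \<gamma>) - g (s + \<gamma>)) < \<delta>"
        using restrict[of \<gamma>] approx[of \<gamma>] that F(2) by auto
      then show ?thesis
        unfolding m_def by (intro power_mono) (auto simp: L2_norm_def)
    qed
    have "m \<gamma> - n \<gamma> = 0" if "\<gamma> \<in> \<Gamma> - F" for \<gamma>
      using restrict[of \<gamma>] that by (simp add: m_def n_def)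
    then have "((\<lambda>\<gamma>. m \<gamma> - n \<gamma>) has_sum (\<Sum>\<gamma>\<in>F. m \<gamma> - n \<gamma>)) \<Gamma>"
      using F by (intro has_sum_finite_neutralI[of F]) auto
    \<comment> \<open>The sums of \<open>m\<close> and \<open>n\<close> differ only on the finite set \<open>F\<close>.\<close>
    from has_sum_add[OF n this]
    have "(m has_sum (L2_norm lebesgue f)\<^sup>2 + (\<Sum>\<gamma>\<in>F. m \<gamma> - n \<gamma>)) \<Gamma>"
      by simp
    then have "(L2_norm lebesgue (\<lambda>s. f s - g s))\<^sup>2 = (L2_norm lebesgue f)\<^sup>2 + (\<Sum>\<gamma>\<in>F. m \<gamma> - n \<gamma>)"
      by (rule has_sum_unique[OF m])
    then have "(L2_norm lebesgue (\<lambda>s. f s - g s))\<^sup>2 = sum m F + ((L2_norm lebesgue f)\<^sup>2 - sum n F)"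
      by (simp add: sum_subtractf)
    also have "\<dots> \<le> real (card F) * \<delta>\<^sup>2 + \<epsilon>\<^sup>2 / 4"
      using sum_bounded_above[of F m "\<delta>\<^sup>2", OF m_less] tail unfolding dist_real_def by linarith
    also have "real (card F) * \<delta>\<^sup>2 \<le> \<epsilon>\<^sup>2 / 2"
      by (simp add: \<delta>_sq divide_simps) (simp add: algebra_simps)
    finally have "(L2_norm lebesgue (\<lambda>s. f s - g s))\<^sup>2 < \<epsilon>\<^sup>2"
      using \<open>0 < \<epsilon>\<close> zero_less_power[of \<epsilon> 2] by linarith
    then have "L2_norm lebesgue (\<lambda>s. f s - g s) < \<epsilon>"
      using \<open>0 < \<epsilon>\<close> by (simp add: power_less_imp_less_base)
    moreover have "g s = (\<Sum>p\<in>G' \<times> F. (case p of (i, \<gamma>) \<Rightarrow> c' i \<gamma>) * ?E p s)" for s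
      unfolding g_def by (intro sum.cong) auto
    ultimately show ?thesis
      using G' F by (intro exI[of _ "G' \<times> F"] exI[of _ "\<lambda>(i, \<gamma>). c' i \<gamma>"]) (auto simp: Sigma_mono)
  qed
  show ?thesis
    unfolding orthogonal_basis_L2_def
  proof (intro conjI ballI allI impI)
    fix p assume "p \<in> I \<times> \<Gamma>"
    then show "?E p \<in> L2 lebesgue" "L2_norm lebesgue (?E p) \<noteq> 0"
      using e e_norm by (auto simp: tile_lift_L2 L2_norm_tile_lift L2_measurable)
  next
    fix p q assume "p \<in> I \<times> \<Gamma>" "q \<in> I \<times> \<Gamma>" "p \<noteq> q"
    then show "L2_inner lebesgue (?E p) (?E q) = 0"
      using inner by (auto split: prod.split)
  qed (rule total)
qed

text \<open>The squared coefficients of \<open>f\<close> against the functions lifted to the tile at \<open>\<gamma>\<close> are those of its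
translate on \<open>\<Omega>\<close>. Adding up the frame inequalities of all tiles gives the claim with the same bounds.\<close>

lemma frame_L2_tile_lift:
  assumes frame: "frame_L2 (lebesgue_on \<Omega>) I e"
  shows "frame_L2 lebesgue (I \<times> \<Gamma>) (\<lambda>(i, \<gamma>). tile_lift \<Omega> (e i) \<gamma>)"
proof -
  let ?N = "lebesgue_on \<Omega>"
  let ?E = "\<lambda>(i, \<gamma>). tile_lift \<Omega> (e i) \<gamma>"
  have "countable I" and e: "\<And>i. i \<in> I \<Longrightarrow> e i \<in> L2 ?N"
    using frame by (auto simp: frame_L2_def)
  obtain A B where AB: "0 < A" "A \<le> B"
    and summable: "\<And>h. h \<in> L2 ?N \<Longrightarrow> (\<lambda>i. (cmod (L2_inner ?N h (e i)))\<^sup>2) summable_on I"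
    and lower: "\<And>h. h \<in> L2 ?N \<Longrightarrow> A * (L2_norm ?N h)\<^sup>2 \<le> (\<Sum>\<^sub>\<infinity>i\<in>I. (cmod (L2_inner ?N h (e i)))\<^sup>2)"
    and upper: "\<And>h. h \<in> L2 ?N \<Longrightarrow> (\<Sum>\<^sub>\<infinity>i\<in>I. (cmod (L2_inner ?N h (e i)))\<^sup>2) \<le> B * (L2_norm ?N h)\<^sup>2"
    using frame unfolding frame_L2_def by blast
  have "(\<lambda>p. (cmod (L2_inner lebesgue f (?E p)))\<^sup>2) summable_on (I \<times> \<Gamma>) \<and>
      A * (L2_norm lebesgue f)\<^sup>2 \<le> (\<Sum>\<^sub>\<infinity>p\<in>I \<times> \<Gamma>. (cmod (L2_inner lebesgue f (?E p)))\<^sup>2) \<and>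
      (\<Sum>\<^sub>\<infinity>p\<in>I \<times> \<Gamma>. (cmod (L2_inner lebesgue f (?E p)))\<^sup>2) \<le> B * (L2_norm lebesgue f)\<^sup>2"
    if f: "f \<in> L2 lebesgue" for f
  proof -
    define n where "n \<gamma> = (L2_norm ?N (\<lambda>s. f (s + \<gamma>)))\<^sup>2" for \<gamma>
    define a where "a \<gamma> i = (cmod (L2_inner ?N (\<lambda>s. f (s + \<gamma>)) (e i)))\<^sup>2" for \<gamma> i
    define b where "b \<gamma> = (\<Sum>\<^sub>\<infinity>i\<in>I. a \<gamma> i)" for \<gamma>
    have n: "(n has_sum (L2_norm lebesgue f)\<^sup>2) \<Gamma>"
      unfolding n_def by (rule has_sum_L2_norm_tiles[OF f])
    have a: "(a \<gamma> has_sum b \<gamma>) I" for \<gamma>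
      unfolding b_def a_def[abs_def] by (rule has_sum_infsum[OF summable[OF shift_L2[OF f]]])
    have nonneg: "0 \<le> a \<gamma> i" for \<gamma> i
      by (simp add: a_def)
    have lower': "A * n \<gamma> \<le> b \<gamma>" and upper': "b \<gamma> \<le> B * n \<gamma>" for \<gamma>
      using lower[OF shift_L2[OF f, of \<gamma>]] upper[OF shift_L2[OF f, of \<gamma>]]
      by (simp_all add: a_def b_def n_def)
    have "b summable_on \<Gamma>"
    proof (rule summable_on_comparison_test[OF _ upper'])
      show "(\<lambda>\<gamma>. B * n \<gamma>) summable_on \<Gamma>"
        using has_sum_cmult_right[OF n] by (rule has_sum_imp_summable)
      show "0 \<le> b \<gamma>" for \<gamma>
        unfolding b_def by (rule infsum_nonneg) (rule nonneg)
    qed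
    then have b: "(b has_sum infsum b \<Gamma>) \<Gamma>"
      by simp
    have "((\<lambda>(\<gamma>, i). a \<gamma> i) has_sum infsum b \<Gamma>) (\<Gamma> \<times> I)"
      by (rule has_sum_SigmaI[OF _ b summable_on_SigmaI[OF _ \<open>b summable_on \<Gamma>\<close>]])
         (use a nonneg in auto)
    then have "((\<lambda>(i, \<gamma>). a \<gamma> i) has_sum infsum b \<Gamma>) (I \<times> \<Gamma>)"
      by (subst (asm) has_sum_swap) simp
    also have "?this \<longleftrightarrow> ((\<lambda>p. (cmod (L2_inner lebesgue f (?E p)))\<^sup>2) has_sum infsum b \<Gamma>) (I \<times> \<Gamma>)"
      using e f by (intro has_sum_cong) (auto simp: a_def L2_inner_tile_lift L2_measurable)
    finally have sum: "((\<lambda>p. (cmod (L2_inner lebesgue f (?E p)))\<^sup>2) has_sum infsum b \<Gamma>) (I \<times> \<Gamma>)" .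
    have "A * (L2_norm lebesgue f)\<^sup>2 \<le> infsum b \<Gamma>"
      using has_sum_mono[OF has_sum_cmult_right[OF n] b] lower' by blast
    moreover have "infsum b \<Gamma> \<le> B * (L2_norm lebesgue f)\<^sup>2"
      using has_sum_mono[OF b has_sum_cmult_right[OF n]] upper' by blast
    ultimately show ?thesis
      using sum by (simp add: has_sum_imp_summable infsumI)
  qed
  moreover have "\<forall>p\<in>I \<times> \<Gamma>. ?E p \<in> L2 lebesgue"
    using e by (auto intro: tile_lift_L2)
  moreover have "countable (I \<times> \<Gamma>)"
    using \<open>countable I\<close> countable_translations by simp
  ultimately show ?thesis
    unfolding frame_L2_def using AB by blast
qed

end

section \<open>The system on the whole space\<close>

theorem proposition7p5:
  fixes A :: "'m::finite \<Rightarrow> real^'d^'d"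
    and l :: "real^'d"
    and \<Lambda> :: "(real^'d) set"
    and \<Omega> \<Gamma> :: "(real^'m) set"
  assumes "\<And>j k. A j ** A k = A k ** A j"
    and "countable \<Lambda>"
    and "\<Omega> \<in> sets borel"
    and "0 < emeasure lebesgue \<Omega>"
    and "emeasure lebesgue \<Omega> < \<infinity>"
    and "ess_injective (lebesgue_on \<Omega>) (orbit_map A l)"
    and "tiles \<Omega> \<Gamma>"
  shows "(spectral_measure (distr (lebesgue_on \<Omega>) borel (orbit_map A l)) \<Lambda> \<longrightarrow>
           orthogonal_basis_L2 lebesgue (\<Lambda> \<times> \<Gamma>)
             (\<lambda>(lam, \<gamma>) s. cis (2 * pi * (orbit_map A l (s - \<gamma>) \<bullet> lam)) * indicator \<Omega> (s - \<gamma>)) \<and>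
           orthogonal_basis_L2 lebesgue (\<Lambda> \<times> \<Gamma>)
             (\<lambda>(lam, \<gamma>). repr A l (action A \<gamma> lam, \<gamma>) (indicator \<Omega>))) \<and>
         (frame_spectral_measure (distr (lebesgue_on \<Omega>) borel (orbit_map A l)) \<Lambda> \<longrightarrow>
           frame_L2 lebesgue (\<Lambda> \<times> \<Gamma>)
             (\<lambda>(lam, \<gamma>) s. cis (2 * pi * (orbit_map A l (s - \<gamma>) \<bullet> lam)) * indicator \<Omega> (s - \<gamma>)) \<and>
           frame_L2 lebesgue (\<Lambda> \<times> \<Gamma>)
             (\<lambda>(lam, \<gamma>). repr A l (action A \<gamma> lam, \<gamma>) (indicator \<Omega>)))"
proof -
  let ?N = "lebesgue_on \<Omega>" and ?\<phi> = "orbit_map A l"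
  let ?lift = "\<lambda>(lam, \<gamma>). tile_lift \<Omega> (\<lambda>s. cis (2 * pi * (lam \<bullet> ?\<phi> s))) \<gamma>"
  interpret lebesgue_tiling \<Omega> \<Gamma>
    using assms by unfold_locales auto
  have \<phi>: "?\<phi> \<in> borel_measurable ?N"
    by (intro measurable_restrict_space1 measurable_completion) simp
  have system: "(\<lambda>(lam, \<gamma>) s. cis (2 * pi * (?\<phi> (s - \<gamma>) \<bullet> lam)) * indicator \<Omega> (s - \<gamma>)) = ?lift"
    by (auto simp: fun_eq_iff tile_lift_def inner_commute)
  have repr_system: "(\<lambda>(lam, \<gamma>). repr A l (action A \<gamma> lam, \<gamma>) (indicator \<Omega>)) = ?lift"
    by (auto simp: fun_eq_iff repr_def tile_lift_def orbit_map_inner_action[OF assms(1)] inner_commute[where y = "?\<phi> s" for s])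
  have "orthogonal_basis_L2 lebesgue (\<Lambda> \<times> \<Gamma>) ?lift" if "spectral_measure (distr ?N borel ?\<phi>) \<Lambda>"
    using that orthogonal_basis_L2_tile_lift[OF orthogonal_basis_L2_distr[OF \<phi> assms(6), of \<Lambda> "\<lambda>lam x. cis (2 * pi * (lam \<bullet> x))"]]
    by (simp add: spectral_measure_def)
  moreover have "frame_L2 lebesgue (\<Lambda> \<times> \<Gamma>) ?lift" if "frame_spectral_measure (distr ?N borel ?\<phi>) \<Lambda>"
    using that frame_L2_tile_lift[OF frame_L2_distr[OF \<phi> assms(6), of \<Lambda> "\<lambda>lam x. cis (2 * pi * (lam \<bullet> x))"]]
    by (simp add: frame_spectral_measure_def)
  ultimately show ?thesis
    unfolding system repr_system by blast
qed

end
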